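(* Let $G$ be a separable topological group metrized by a right-invariant metric, and let $\mu$ be a regular Borel measure on $G$ (that is, $\mu\in\mathcal{M}(G)$). Then $\mu$ has the Steinhaus-Weil property, i.e. $1_G\in\mathrm{int}(AA^{-1})$ for every $\mu$-measurable set $A$ with $0<\mu(A)<\infty$, if and only if (i) holds, and also if and only if (ii) holds, where: (i) for each compact $K\subseteq G$ with $\mu(K)>0$, the map $m_K:t\mapsto\mu(tK)$ is subcontinuous at $1_G$; (ii) for each compact $K\subseteq G$ with $\mu(K)>0$, there is no sequence $t_n\to1_G$ with $\mu(t_nK)\to0$.
   Context: $\mathcal{M}(G)$ denotes the $\sigma$-finite Borel measures on $G$ that are regular, meaning both inner regular (approximation from inside by compact sets) and outer regular (approximation from outside by open sets). For compact $K$ with $\mu(K)>0$, the map $m_K(t)=\mu(tK)$ is subcontinuous at $1_G$ if for every sequence $t_n\to1_G$ there is a subsequence $t_{m(n)}$ along which $\mu(t_{m(n)}K)$ is bounded away from $0$. *)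

theory Defs
  imports "HOL-Analysis.Analysis"
begin

text \<open>
  Groups are instances of the class \<^class>\<open>topological_group_add\<close>. This class does not
  assume commutativity, so it covers arbitrary topological groups; only the notation is additive:
  \<open>0\<close> is the identity, \<open>t + x\<close> the product \<open>t x\<close>, and \<open>a - b\<close> the product of \<open>a\<close> with the
  inverse of \<open>b\<close>, in this order.
\<close>

definition inner_regular_measure :: "'a::topological_space measure \<Rightarrow> bool" where
  "inner_regular_measure \<mu> \<longleftrightarrow>
     (\<forall>B\<in>sets \<mu>. emeasure \<mu> B = (SUP K\<in>{K. K \<subseteq> B \<and> compact K}. emeasure \<mu> K))"

definition outer_regular_measure :: "'a::topological_space measure \<Rightarrow> bool" where
  "outer_regular_measure \<mu> \<longleftrightarrow>
     (\<forall>B\<in>sets \<mu>. emeasure \<mu> B = (INF U\<in>{U. B \<subseteq> U \<and> open U}. emeasure \<mu> U))"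

definition regular_borel_measure :: "'a::topological_space measure \<Rightarrow> bool" where
  "regular_borel_measure \<mu> \<longleftrightarrow>
     sets \<mu> = sets borel \<and> sigma_finite_measure \<mu> \<and>
     inner_regular_measure \<mu> \<and> outer_regular_measure \<mu>"

text \<open>
  A set is \<open>\<mu>\<close>-measurable if it belongs to the completion of \<open>\<mu>\<close>, i.e. if it differs from a Borel
  set by a subset of a \<open>\<mu>\<close>-null Borel set.
\<close>

definition steinhaus_weil :: "'a::topological_group_add measure \<Rightarrow> bool" where
  "steinhaus_weil \<mu> \<longleftrightarrow>
     (\<forall>A\<in>sets (completion \<mu>).
        0 < emeasure (completion \<mu>) A \<and> emeasure (completion \<mu>) A < \<infinity> \<longrightarrow>
        0 \<in> interior {a - b |a b. a \<in> A \<and> b \<in> A})"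

definition translate_measure :: "'a::topological_group_add measure \<Rightarrow> 'a set \<Rightarrow> 'a \<Rightarrow> ennreal" where
  "translate_measure \<mu> K t = emeasure \<mu> ((\<lambda>x. t + x) ` K)"

definition subcontinuous_at :: "('a::topological_space \<Rightarrow> ennreal) \<Rightarrow> 'a \<Rightarrow> bool" where
  "subcontinuous_at f x \<longleftrightarrow>
     (\<forall>t :: nat \<Rightarrow> 'a. t \<longlonglongrightarrow> x \<longrightarrow>
        (\<exists>m :: nat \<Rightarrow> nat. strict_mono m \<and> (\<exists>\<delta>>0. \<forall>n. \<delta> \<le> f (t (m n)))))"

end

theory Submission
  imports Defs
begin

text \<open>
  If \<open>t + K\<close> misses \<open>K\<close> for \<open>t\<close> arbitrarily close to \<open>0\<close>, then outer regularity forces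
  \<open>\<mu>(t + K) \<rightarrow> 0\<close> along such \<open>t\<close>, since \<open>t + K\<close> lies in a neighbourhood of \<open>K\<close> of
  almost the same measure. Hence (ii) for a compact \<open>K \<subseteq> A\<close> yields the Steinhaus-Weil property
  for \<open>A\<close>. Conversely, if \<open>\<mu>(t\<^sub>n + K) \<rightarrow> 0\<close>, pass to a subsequence with
  \<open>\<Sum>\<mu>(t\<^sub>n + K) < \<mu>(K)\<close>; then \<open>A = K - \<Union>(t\<^sub>n + K)\<close> has positive measure, but no
  \<open>t\<^sub>n\<close> is a difference of two points of \<open>A\<close>.
\<close>

section \<open>Left translates in a topological group\<close>

lemma diff_set_iff_translate_meets:
  fixes A :: "'a::group_add set"
  shows "t \<in> {a - b |a b. a \<in> A \<and> b \<in> A} \<longleftrightarrow> (\<lambda>x. t + x) ` A \<inter> A \<noteq> {}"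
proof
  assume "t \<in> {a - b |a b. a \<in> A \<and> b \<in> A}"
  then obtain a b where ab: "t = a - b" "a \<in> A" "b \<in> A" by blast
  then have "t + b = a" by simp
  then show "(\<lambda>x. t + x) ` A \<inter> A \<noteq> {}" using ab by blast
next
  assume "(\<lambda>x. t + x) ` A \<inter> A \<noteq> {}"
  then obtain b where b: "b \<in> A" "t + b \<in> A" by blast
  then have "t = (t + b) - b" by simp
  then show "t \<in> {a - b |a b. a \<in> A \<and> b \<in> A}" using b by blast
qed

text \<open>A tube-lemma argument: continuity of addition at \<open>(0, x)\<close> gives each
  \<open>x\<close> in \<open>K\<close> a neighbourhood on which one neighbourhood of
  \<open>0\<close> works for all points. Finitely many of these cover \<open>K\<close>, and the
  finitely many conditions on \<open>t\<close> hold together.\<close>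

lemma eventually_translate_subset:
  fixes K :: "'a::topological_monoid_add set"
  assumes K: "compact K" and U: "open U" "K \<subseteq> U"
  shows "\<forall>\<^sub>F t in nhds 0. (\<lambda>x. t + x) ` K \<subseteq> U"
proof -
  have "\<forall>x\<in>K. \<exists>V. open V \<and> x \<in> V \<and> (\<forall>\<^sub>F t in nhds 0. \<forall>y\<in>V. t + y \<in> U)"
  proof
    fix x
    assume "x \<in> K"
    have "\<forall>\<^sub>F p in nhds 0 \<times>\<^sub>F nhds x. fst p + snd p \<in> U"
      using tendsto_add_Pair[of 0 x] U \<open>x \<in> K\<close>
      by (auto simp: case_prod_unfold nhds_prod elim!: topological_tendstoD)
    then obtain P Q where P: "eventually P (nhds 0)" and Q: "eventually Q (nhds x)"
      and PQ: "\<And>t y. P t \<Longrightarrow> Q y \<Longrightarrow> t + y \<in> U"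
      unfolding eventually_prod_filter by force
    from Q obtain V where "open V" "x \<in> V" "\<And>y. y \<in> V \<Longrightarrow> Q y"
      unfolding eventually_nhds by blast
    moreover have "\<forall>\<^sub>F t in nhds 0. \<forall>y\<in>V. t + y \<in> U"
      using P by (rule eventually_mono) (use PQ \<open>\<And>y. y \<in> V \<Longrightarrow> Q y\<close> in blast)
    ultimately show "\<exists>V. open V \<and> x \<in> V \<and> (\<forall>\<^sub>F t in nhds 0. \<forall>y\<in>V. t + y \<in> U)"
      by blast
  qed
  from bchoice[OF this] obtain V where V: "\<forall>x\<in>K. open (V x) \<and> x \<in> V x \<and> (\<forall>\<^sub>F t in nhds 0. \<forall>y\<in>V x. t + y \<in> U)"
    by blast
  obtain C where C: "C \<subseteq> K" "finite C" "K \<subseteq> (\<Union>x\<in>C. V x)"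
    by (rule compactE_image[OF K, of K V]) (use V in auto)
  have "\<forall>\<^sub>F t in nhds 0. \<forall>x\<in>C. \<forall>y\<in>V x. t + y \<in> U"
    using C V by (intro eventually_ball_finite) auto
  then show ?thesis
    by eventually_elim (use C in blast)
qed

lemma compact_translate:
  fixes K :: "'a::topological_monoid_add set"
  assumes "compact K"
  shows "compact ((\<lambda>x. t + x) ` K)"
  by (rule compact_continuous_image[OF _ assms]) (intro continuous_intros)

section \<open>Approximation by open and compact sets, and finiteness on compact sets\<close>

lemma outer_regular_measure_open_lt:
  assumes "outer_regular_measure \<mu>" "B \<in> sets \<mu>" "emeasure \<mu> B < c"
  obtains U where "open U" "B \<subseteq> U" "emeasure \<mu> U < c"
proof -
  have "emeasure \<mu> B = (INF U\<in>{U. B \<subseteq> U \<and> open U}. emeasure \<mu> U)"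
    using assms(1,2) unfolding outer_regular_measure_def by (rule bspec)
  with assms(3) have "(INF U\<in>{U. B \<subseteq> U \<and> open U}. emeasure \<mu> U) < c"
    by (rule subst[rotated])
  then show ?thesis
    using that by (auto simp: INF_less_iff)
qed

lemma inner_regular_measure_compact_pos:
  assumes "inner_regular_measure \<mu>" "B \<in> sets \<mu>" "0 < emeasure \<mu> B"
  obtains K where "compact K" "K \<subseteq> B" "0 < emeasure \<mu> K"
proof -
  have "emeasure \<mu> B = (SUP K\<in>{K. K \<subseteq> B \<and> compact K}. emeasure \<mu> K)"
    using assms(1,2) unfolding inner_regular_measure_def by (rule bspec)
  with assms(3) have "0 < (SUP K\<in>{K. K \<subseteq> B \<and> compact K}. emeasure \<mu> K)"
    by (rule subst[rotated])
  then show ?thesis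
    using that by (auto simp: less_SUP_iff)
qed

lemma sets_regular_borel_compact:
  fixes \<mu> :: "'a::t2_space measure"
  assumes "regular_borel_measure \<mu>" "compact K"
  shows "K \<in> sets \<mu>"
  using assms by (simp add: regular_borel_measure_def borel_compact)

text \<open>By sigma-finiteness the point lies in one of countably many sets of finite measure. This
  is the input that lets outer regularity produce open neighbourhoods of finite measure.\<close>

lemma regular_borel_measure_singleton_finite:
  fixes \<mu> :: "'a::t2_space measure"
  assumes "regular_borel_measure \<mu>"
  shows "emeasure \<mu> {x} < \<infinity>"
proof -
  have s: "sets \<mu> = sets borel" and "sigma_finite_measure \<mu>"
    using assms by (auto simp: regular_borel_measure_def)
  then interpret sigma_finite_measure \<mu> by simp
  have "x \<in> space \<mu>"
    using sets_eq_imp_space_eq[OF s] by simp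
  obtain A :: "nat \<Rightarrow> 'a set" where A: "range A \<subseteq> sets \<mu>" "(\<Union>i. A i) = space \<mu>"
    "\<And>i. emeasure \<mu> (A i) \<noteq> \<infinity>"
    using sigma_finite by metis
  then obtain i where i: "x \<in> A i" using \<open>x \<in> space \<mu>\<close> by blast
  have "emeasure \<mu> {x} \<le> emeasure \<mu> (A i)"
    using A i by (intro emeasure_mono) auto
  with A(3)[of i] show ?thesis
    by (simp add: top.not_eq_extremum order.strict_trans1)
qed

text \<open>Outer regularity at single points makes the measure locally finite.\<close>

lemma regular_borel_measure_compact_finite:
  fixes \<mu> :: "'a::t2_space measure"
  assumes "regular_borel_measure \<mu>" and K: "compact K"
  shows "emeasure \<mu> K < \<infinity>"
proof -
  have s: "sets \<mu> = sets borel" and outer: "outer_regular_measure \<mu>"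
    using assms by (auto simp: regular_borel_measure_def)
  have "\<exists>U. open U \<and> x \<in> U \<and> emeasure \<mu> U < \<infinity>" for x
    using outer_regular_measure_open_lt[OF outer _ regular_borel_measure_singleton_finite[OF assms(1)]]
    by (metis assms(1) compact_insert compact_empty insert_subset sets_regular_borel_compact)
  then obtain U where U: "\<And>x. open (U x)" "\<And>x. x \<in> U x" "\<And>x. emeasure \<mu> (U x) < \<infinity>"
    by metis
  obtain C where C: "finite C" "K \<subseteq> (\<Union>x\<in>C. U x)"
    by (rule compactE_image[OF K, of K U]) (use U in auto)
  have "emeasure \<mu> K \<le> emeasure \<mu> (\<Union>x\<in>C. U x)"
    using C U s by (intro emeasure_mono) auto
  also have "\<dots> \<le> (\<Sum>x\<in>C. emeasure \<mu> (U x))"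
    using C U s by (intro emeasure_subadditive_finite) auto
  also have "\<dots> < \<infinity>"
    using C U by (simp add: less_top[symmetric])
  finally show ?thesis .
qed

section \<open>The two implications between the Steinhaus-Weil property and condition (ii)\<close>

lemma tendsto_translate_measure_disjoint:
  fixes \<mu> :: "'a::{topological_group_add, t2_space} measure"
  assumes reg: "regular_borel_measure \<mu>" and K: "compact K"
    and t: "(t \<longlongrightarrow> 0) F"
    and disj: "\<forall>\<^sub>F n in F. (\<lambda>x. t n + x) ` K \<inter> K = {}"
  shows "((\<lambda>n. translate_measure \<mu> K (t n)) \<longlongrightarrow> 0) F"
proof (rule order_tendstoI)
  fix e :: ennreal
  assume "0 < e"
  have s: "sets \<mu> = sets borel" and outer: "outer_regular_measure \<mu>"
    using reg by (auto simp: regular_borel_measure_def)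
  have fin: "emeasure \<mu> K < \<infinity>"
    by (rule regular_borel_measure_compact_finite[OF reg K])
  \<comment> \<open>Strictness needs \<mu>(K) finite; it leaves room for an open \<open>U\<close>
    around \<open>K\<close> with excess measure below \<open>e\<close>.\<close>
  then have "emeasure \<mu> K < emeasure \<mu> K + e"
    using \<open>0 < e\<close> by (cases "emeasure \<mu> K"; cases e) (auto simp: ennreal_plus[symmetric] ennreal_less_iff simp del: ennreal_plus)
  then obtain U where U: "open U" "K \<subseteq> U" "emeasure \<mu> U < emeasure \<mu> K + e"
    using outer_regular_measure_open_lt[OF outer sets_regular_borel_compact[OF reg K]] by blast
  have "\<forall>\<^sub>F n in F. (\<lambda>x. t n + x) ` K \<subseteq> U"
    using eventually_translate_subset[OF K U(1,2)] t by (rule eventually_compose_filterlim)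
  with disj show "\<forall>\<^sub>F n in F. translate_measure \<mu> K (t n) < e"
  proof eventually_elim
    case (elim n)
    \<comment> \<open>Both \<open>K\<close> and its translate lie in \<open>U\<close> and are
      disjoint, so the translate has to fit into the excess, which is below
      \<open>e\<close>.\<close>
    have "emeasure \<mu> K + emeasure \<mu> ((\<lambda>x. t n + x) ` K) = emeasure \<mu> (K \<union> (\<lambda>x. t n + x) ` K)"
      using elim K by (intro plus_emeasure sets_regular_borel_compact[OF reg] compact_translate) auto
    also have "\<dots> \<le> emeasure \<mu> U"
      using elim U s by (intro emeasure_mono) auto
    also have "\<dots> < emeasure \<mu> K + e"
      by (rule U)
    finally show ?case
      by (simp add: translate_measure_def ennreal_add_left_cancel_less)
  qed
qed simp

lemma steinhaus_weil_if_no_null_translates: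
  fixes \<mu> :: "'a::{topological_group_add, t2_space, first_countable_topology} measure"
  assumes reg: "regular_borel_measure \<mu>"
    and no_null: "\<And>K t. compact K \<Longrightarrow> 0 < emeasure \<mu> K \<Longrightarrow> t \<longlonglongrightarrow> 0 \<Longrightarrow>
      \<not> (\<lambda>n::nat. translate_measure \<mu> K (t n)) \<longlonglongrightarrow> 0"
  shows "steinhaus_weil \<mu>"
  unfolding steinhaus_weil_def
proof (intro ballI impI, elim conjE)
  fix A
  assume A: "A \<in> sets (completion \<mu>)" and pos: "0 < emeasure (completion \<mu>) A"
  have inner: "inner_regular_measure \<mu>"
    using reg by (simp add: regular_borel_measure_def)
  \<comment> \<open>\<open>A\<close> is only measurable for the completion, so inner regularity is
    applied to its Borel part, which has the same measure.\<close>
  have "0 < emeasure \<mu> (main_part \<mu> A)"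
    using A pos by simp
  then obtain K where K: "compact K" "K \<subseteq> main_part \<mu> A" "0 < emeasure \<mu> K"
    using inner_regular_measure_compact_pos[OF inner main_part_sets[OF A]] by blast
  have KA: "K \<subseteq> A"
    using K(2) main_part_null_part_Un[OF A] by blast
  have "\<forall>\<^sub>F t in nhds 0. (\<lambda>x. t + x) ` K \<inter> K \<noteq> {}"
  proof (rule ccontr)
    assume "\<not> (\<forall>\<^sub>F t in nhds 0. (\<lambda>x. t + x) ` K \<inter> K \<noteq> {})"
    \<comment> \<open>First countability lets sequences test the neighbourhood filter of
      \<open>0\<close>. The resulting sequence has disjoint translates only infinitely often;
      enumerating those indices gives a subsequence \<open>u\<close> with disjointness at every
      index.\<close>
    then obtain t :: "nat \<Rightarrow> 'a" where t: "t \<longlonglongrightarrow> 0"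
      and "\<exists>\<^sub>F n in sequentially. (\<lambda>x. t n + x) ` K \<inter> K = {}"
      by (auto simp: eventually_nhds_iff_sequentially frequently_def)
    then have inf: "infinite {n. (\<lambda>x. t n + x) ` K \<inter> K = {}}" (is "infinite ?S")
      by (simp add: cofinite_eq_sequentially[symmetric] frequently_cofinite)
    define u where "u = t \<circ> enumerate ?S"
    have u: "u \<longlonglongrightarrow> 0"
      unfolding u_def by (rule LIMSEQ_subseq_LIMSEQ[OF t strict_mono_enumerate[OF inf]])
    have "(\<lambda>x. u n + x) ` K \<inter> K = {}" for n
      using enumerate_in_set[OF inf, of n] by (simp add: u_def)
    then have "(\<lambda>n. translate_measure \<mu> K (u n)) \<longlonglongrightarrow> 0"
      by (intro tendsto_translate_measure_disjoint[OF reg K(1) u] always_eventually allI)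
    then show False
      using no_null[OF K(1,3) u] by contradiction
  qed
  then have "\<forall>\<^sub>F t in nhds 0. t \<in> {a - b |a b. a \<in> A \<and> b \<in> A}"
    unfolding diff_set_iff_translate_meets by eventually_elim (use KA in blast)
  then show "0 \<in> interior {a - b |a b. a \<in> A \<and> b \<in> A}"
    by (auto simp: eventually_nhds interior_def)
qed

lemma not_steinhaus_weil_if_null_translates:
  fixes \<mu> :: "'a::{topological_group_add, t2_space} measure"
  assumes reg: "regular_borel_measure \<mu>" and K: "compact K" "0 < emeasure \<mu> K"
    and t: "t \<longlonglongrightarrow> 0" and null: "(\<lambda>n::nat. translate_measure \<mu> K (t n)) \<longlonglongrightarrow> 0"
  shows "\<not> steinhaus_weil \<mu>"
proof
  assume sw: "steinhaus_weil \<mu>"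
  \<comment> \<open>The total mass of the removed translates will be bounded by \<open>c\<close>, so
    choosing \<open>c\<close> strictly below \<mu>(K) leaves positive measure.\<close>
  obtain c where c: "0 < c" "c < emeasure \<mu> K"
    using dense[OF K(2)] by blast
  \<comment> \<open>The weights \<open>(1/2) ^ Suc n\<close> sum to 1 over all \<open>n\<close> from
    0, so the bounds sum to exactly \<open>c\<close>.\<close>
  have "\<exists>m\<ge>n. translate_measure \<mu> K (t m) < c * ennreal ((1/2) ^ Suc n)" for n
  proof -
    have "0 < c * ennreal ((1/2) ^ Suc n)"
      using c(1) by (simp add: ennreal_zero_less_mult_iff del: power_Suc)
    from eventually_happens'[OF _ eventually_conj[OF eventually_ge_at_top[of n] order_tendstoD(2)[OF null this]]]
    show ?thesis
      by simp
  qed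
  then obtain m where m: "\<And>n. m n \<ge> n"
    "\<And>n. translate_measure \<mu> K (t (m n)) < c * ennreal ((1/2) ^ Suc n)"
    by metis
  define N where "N = (\<Union>n. (\<lambda>x. t (m n) + x) ` K)"
  define A where "A = K - N"
  have K_sets: "K \<in> sets \<mu>" and translate_sets: "(\<lambda>x. s + x) ` K \<in> sets \<mu>" for s
    using K reg by (auto intro: sets_regular_borel_compact compact_translate)
  then have N_sets: "N \<in> sets \<mu>"
    unfolding N_def by blast
  then have A_sets: "A \<in> sets \<mu>"
    unfolding A_def using K_sets by blast
  have "emeasure \<mu> N \<le> (\<Sum>n. emeasure \<mu> ((\<lambda>x. t (m n) + x) ` K))"
    unfolding N_def using translate_sets by (intro emeasure_subadditive_countably) auto
  also have "\<dots> \<le> (\<Sum>n. c * ennreal ((1/2) ^ Suc n))"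
    using m(2) by (intro suminf_le) (auto simp: translate_measure_def intro: less_imp_le)
  also have "\<dots> = c * (\<Sum>n. ennreal ((1/2) ^ Suc n))"
    by (rule ennreal_suminf_cmult)
  also have "\<dots> = c"
    by (subst suminf_ennreal_eq[OF zero_le_power power_half_series]) auto
  finally have "emeasure \<mu> N < emeasure \<mu> K"
    using c by simp
  moreover have "emeasure \<mu> K \<le> emeasure \<mu> A + emeasure \<mu> N"
  proof -
    have "emeasure \<mu> K \<le> emeasure \<mu> (A \<union> N)"
      using K_sets N_sets by (intro emeasure_mono) (auto simp: A_def)
    also have "\<dots> \<le> emeasure \<mu> A + emeasure \<mu> N"
      by (rule emeasure_subadditive[OF A_sets N_sets])
    finally show ?thesis .
  qed
  \<comment> \<open>If \<open>A\<close> were null, then \<mu>(K) \<le> \<mu>(N) < \<mu>(K).\<close>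
  ultimately have "0 < emeasure \<mu> A"
    by (cases "emeasure \<mu> A = 0") (auto simp: zero_less_iff_neq_zero)
  moreover have "emeasure \<mu> A < \<infinity>"
    using regular_borel_measure_compact_finite[OF reg K(1)] K_sets
    by (intro order.strict_trans1[OF emeasure_mono[of A K]]) (auto simp: A_def)
  \<comment> \<open>\<open>A\<close> is Borel, so the completion measures it with the same
    value.\<close>
  ultimately have zero: "0 \<in> interior {a - b |a b. a \<in> A \<and> b \<in> A}"
    using sw A_sets unfolding steinhaus_weil_def by simp
  \<comment> \<open>The indices \<open>m n\<close> may repeat or decrease;
    \<open>m n \<ge> n\<close> alone keeps \<open>t (m n)\<close> converging to
    \<open>0\<close>.\<close>
  have "filterlim m sequentially sequentially"
    using m(1) by (intro filterlim_at_top_mono[OF filterlim_ident]) auto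
  then have "(\<lambda>n. t (m n)) \<longlonglongrightarrow> 0"
    by (rule filterlim_compose[OF t])
  then have "\<forall>\<^sub>F n in sequentially. t (m n) \<in> interior {a - b |a b. a \<in> A \<and> b \<in> A}"
    using zero by (intro topological_tendstoD) auto
  then obtain n where "t (m n) \<in> {a - b |a b. a \<in> A \<and> b \<in> A}"
    using interior_subset by (force simp: eventually_sequentially)
  \<comment> \<open>The translate of \<open>A\<close> by \<open>t (m n)\<close> lies in that of
    \<open>K\<close>, hence in \<open>N\<close>, and \<open>A\<close> avoids
    \<open>N\<close>.\<close>
  then show False
    unfolding diff_set_iff_translate_meets by (auto simp: A_def N_def)
qed

section \<open>Subcontinuity as the absence of vanishing sequences, and the conclusion\<close>

lemma subcontinuous_at_iff_not_tendsto_0: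
  "subcontinuous_at f x \<longleftrightarrow> \<not> (\<exists>t :: nat \<Rightarrow> _. t \<longlonglongrightarrow> x \<and> (\<lambda>n. f (t n)) \<longlonglongrightarrow> 0)"
proof
  assume sub: "subcontinuous_at f x"
  show "\<not> (\<exists>t :: nat \<Rightarrow> _. t \<longlonglongrightarrow> x \<and> (\<lambda>n. f (t n)) \<longlonglongrightarrow> 0)"
  proof
    assume "\<exists>t :: nat \<Rightarrow> _. t \<longlonglongrightarrow> x \<and> (\<lambda>n. f (t n)) \<longlonglongrightarrow> 0"
    then obtain t where t: "t \<longlonglongrightarrow> x" "(\<lambda>n. f (t n)) \<longlonglongrightarrow> 0" by blast
    then obtain m \<delta> where m: "strict_mono m" "\<delta> > 0" "\<And>n::nat. \<delta> \<le> f (t (m n))"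
      using sub unfolding subcontinuous_at_def by blast
    have "(\<lambda>n. f (t (m n))) \<longlonglongrightarrow> 0"
      using LIMSEQ_subseq_LIMSEQ[OF t(2) m(1)] by (simp add: o_def)
    \<comment> \<open>A lower bound along the subsequence passes to its limit.\<close>
    then have "\<delta> \<le> 0"
      using m(3) by (intro LIMSEQ_le_const) auto
    with m(2) show False by simp
  qed
next
  assume none: "\<not> (\<exists>t :: nat \<Rightarrow> _. t \<longlonglongrightarrow> x \<and> (\<lambda>n. f (t n)) \<longlonglongrightarrow> 0)"
  show "subcontinuous_at f x"
    unfolding subcontinuous_at_def
  proof (intro allI impI)
    fix t :: "nat \<Rightarrow> _"
    assume "t \<longlonglongrightarrow> x"
    then have "\<not> (\<lambda>n. f (t n)) \<longlonglongrightarrow> 0"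
      using none by blast
    \<comment> \<open>Values in \<open>ennreal\<close> are nonnegative, so convergence to
      \<open>0\<close> can fail only because some \<delta> > 0 is a lower bound infinitely often.
      Enumerating those indices gives the subsequence required.\<close>
    then obtain \<delta> where "\<delta> > 0" "\<not> (\<forall>\<^sub>F n in sequentially. f (t n) < \<delta>)"
      by (auto simp: order_tendsto_iff)
    then have inf: "infinite {n. \<delta> \<le> f (t n)}"
      by (simp add: cofinite_eq_sequentially[symmetric] eventually_cofinite not_less)
    then show "\<exists>m :: nat \<Rightarrow> nat. strict_mono m \<and> (\<exists>\<delta>>0. \<forall>n. \<delta> \<le> f (t (m n)))"
      using strict_mono_enumerate[OF inf] enumerate_in_set[OF inf] \<open>\<delta> > 0\<close> by blast
  qed
qed

theorem proposition2:
  fixes \<mu> :: "'a::{topological_group_add, metric_space} measure"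
  assumes separable: "separable_space (euclidean :: 'a topology)"
    and right_invariant: "\<And>x y z :: 'a. dist (x + z) (y + z) = dist x y"
    and regular: "regular_borel_measure \<mu>"
  shows "(steinhaus_weil \<mu> \<longleftrightarrow>
            (\<forall>K. compact K \<and> 0 < emeasure \<mu> K \<longrightarrow> subcontinuous_at (translate_measure \<mu> K) 0)) \<and>
         (steinhaus_weil \<mu> \<longleftrightarrow>
            (\<forall>K. compact K \<and> 0 < emeasure \<mu> K \<longrightarrow>
               \<not> (\<exists>t :: nat \<Rightarrow> 'a. t \<longlonglongrightarrow> 0 \<and> (\<lambda>n. translate_measure \<mu> K (t n)) \<longlonglongrightarrow> 0)))"
proof -
  have "steinhaus_weil \<mu> \<longleftrightarrow>
      (\<forall>K. compact K \<and> 0 < emeasure \<mu> K \<longrightarrow>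
         \<not> (\<exists>t :: nat \<Rightarrow> 'a. t \<longlonglongrightarrow> 0 \<and> (\<lambda>n. translate_measure \<mu> K (t n)) \<longlonglongrightarrow> 0))"
    using steinhaus_weil_if_no_null_translates[OF regular]
      not_steinhaus_weil_if_null_translates[OF regular] by blast
  \<comment> \<open>Conditions (i) and (ii) agree for each \<open>K\<close> separately, so the
    equivalence with (ii) also gives the one with (i).\<close>
  then show ?thesis
    unfolding subcontinuous_at_iff_not_tendsto_0 by blast
qed

end
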